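(* Let $\mathrm{G}$ be an undirected weighted loopless graph on nodes $\{1,\dots,N\}$ with positive edge weights and symmetric weighted adjacency matrix $\mathbf{W}$, let $\sigma\in\mathbb{R}$, and let $\tilde{\mathbf{L}}_{\mathrm{G}}$ be its symmetrically normalized Laplacian. Let $\mathbf{U}=[u_{i,j}]_{i,j=1}^{N}$ with $u_{i,j}=\frac{\sigma^{2}}{\sigma^{2}+1}\frac{\mathbf{W}(i,j)}{\sqrt{\mathrm{deg}_{\mathbf{W}}(i)\,\mathrm{deg}_{\mathbf{W}}(j)}}$ if $(i,j)$ is an edge of $\mathrm{G}$ and $u_{i,j}=0$ otherwise. Let $m\ge 1$ be an integer, $p_{\mathrm{term}}\in(0,1)$, and let $\mathrm{sample}$ be a non-degenerate sampling strategy on $\mathrm{G}_{\mathbf{U}}$. Let $\mathbf{C}\in\mathbb{R}^{N\times N}$ be the random matrix whose $i$-th row is $\frac{1}{\sigma^{2}+1}\phi(i)^{\top}$ for $i=1,\dots,N$, where $\phi(i)\in\mathbb{R}^{N}$ is the signature vector of node $i$ computed on $\mathrm{G}_{\mathbf{U}}$ by the random-walk procedure described in the context, and let $\mathbf{C}'$ be an independent copy of $\mathbf{C}$. Then the kernel matrix of the $2$-regularized Laplacian kernel of $\mathrm{G}$ satisfies $$(\mathbf{I}_{N}+\sigma^{2}\tilde{\mathbf{L}}_{\mathrm{G}})^{-2}=\mathbb{E}\left[\mathbf{C}(\mathbf{C}')^{\top}\right].$$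
   Context: Degrees: $\mathrm{deg}_{\mathbf{W}}(i)=\sum_{j}\mathbf{W}(i,j)$, the sum being over the neighbors $j$ of $i$ in $\mathrm{G}$. The symmetrically normalized Laplacian $\tilde{\mathbf{L}}_{\mathrm{G}}\in\mathbb{R}^{N\times N}$ has $\tilde{\mathbf{L}}_{\mathrm{G}}(v,v)=1$, $\tilde{\mathbf{L}}_{\mathrm{G}}(v,w)=-\frac{\mathbf{W}(v,w)}{\sqrt{\mathrm{deg}_{\mathbf{W}}(v)\mathrm{deg}_{\mathbf{W}}(w)}}$ if $(v,w)$ is an edge, and all other entries $0$. The $d$-regularized Laplacian kernel of $\mathrm{G}$ is the kernel on nodes with kernel matrix $(\mathbf{I}_{N}+\sigma^{2}\tilde{\mathbf{L}}_{\mathrm{G}})^{-d}$. $\mathrm{G}_{\mathbf{U}}$ is the weighted graph on vertex set $\{1,\dots,N\}$ with weighted adjacency matrix $\mathbf{U}$: the neighbors of $v$ are the $w$ with $u_{v,w}>0$, and $u_{v,w}$ is the weight of the edge $(v,w)$. Sampling strategy: $\mathrm{sample}(v,\mathrm{G}_{\mathbf{U}},\mathcal{H})$ takes the current vertex $v$, the graph, and a history $\mathcal{H}$ (some function of the list of edges traversed so far during the current run of the procedure, over all its walks). Conditionally on everything that has happened before, it draws a random neighbor $w$ of $v$ from a probability distribution on the neighbors of $v$ determined by $v$, $\mathrm{G}_{\mathbf{U}}$ and $\mathcal{H}$, and returns $w$ together with the probability $p$ with which this $w$ was drawn. It is non-degenerate if it always assigns a positive probability to every neighbor $w$ of $v$.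 Procedure computing the signature vector $\phi(i)$, for a fixed node $i$: 1. Set $\phi(i)[j]=0$ for $j=1,\dots,N$, and $\mathcal{H}=\emptyset$. 2. For $t=1,\dots,m$ (the $t$-th random walk): set $\mathrm{load}=1$, set the current vertex to $i$, and add $1$ to $\phi(i)[i]$. Then repeat the following until the walk terminates. Before each transition, the walk terminates with probability $p_{\mathrm{term}}$, independently of everything else (it also terminates if the current vertex has no neighbors). If it does not terminate, let $v$ be the current vertex; obtain $(w,p)=\mathrm{sample}(v,\mathrm{G}_{\mathbf{U}},\mathcal{H})$; move to $w$; replace $\mathrm{load}$ by $\mathrm{load}\cdot\dfrac{u_{v,w}}{p\,(1-p_{\mathrm{term}})}$; add the new $\mathrm{load}$ to $\phi(i)[w]$; add the edge $(v,w)$ to $\mathcal{H}$. 3. Replace $\phi(i)$ by $\phi(i)/m$ and return it. The computations of $\phi(i)$ for different $i$ are carried out independently. $\mathbf{I}_N$ is the identity matrix. *)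

theory Defs
  imports "HOL-Probability.Probability"
begin

text \<open>The nodes \<open>1, \<dots>, N\<close> are the elements of an arbitrary finite type \<open>'n\<close>, so \<open>N = CARD('n)\<close>.\<close>

definition weighted_graph :: "'n rel \<Rightarrow> real^'n^'n \<Rightarrow> bool" where
  "weighted_graph E W \<longleftrightarrow>
     sym E \<and> irrefl E \<and> transpose W = W \<and>
     (\<forall>i j. (i, j) \<in> E \<longrightarrow> W $ i $ j > 0) \<and>
     (\<forall>i j. (i, j) \<notin> E \<longrightarrow> W $ i $ j = 0)"

definition weighted_degree :: "'n rel \<Rightarrow> real^'n^'n \<Rightarrow> 'n::finite \<Rightarrow> real" where
  "weighted_degree E W i = (\<Sum>j | (i, j) \<in> E. W $ i $ j)"

definition normalized_laplacian :: "'n rel \<Rightarrow> real^'n^'n \<Rightarrow> real^'n^'n::finite" where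
  "normalized_laplacian E W =
     (\<chi> v w. if v = w then 1
            else if (v, w) \<in> E
              then - (W $ v $ w / sqrt (weighted_degree E W v * weighted_degree E W w))
            else 0)"

definition matrix_power :: "real^'n^'n \<Rightarrow> nat \<Rightarrow> real^'n^'n::finite" where
  "matrix_power A d = ((**) A ^^ d) (mat 1)"

definition regularized_laplacian_kernel ::
  "nat \<Rightarrow> real \<Rightarrow> 'n rel \<Rightarrow> real^'n^'n \<Rightarrow> real^'n^'n::finite" where
  "regularized_laplacian_kernel d \<sigma> E W =
     matrix_inv (matrix_power (mat 1 + \<sigma>\<^sup>2 *\<^sub>R normalized_laplacian E W) d)"

definition walk_matrix :: "real \<Rightarrow> 'n rel \<Rightarrow> real^'n^'n \<Rightarrow> real^'n^'n::finite" where
  "walk_matrix \<sigma> E W =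
     (\<chi> i j. if (i, j) \<in> E
            then \<sigma>\<^sup>2 / (\<sigma>\<^sup>2 + 1) * (W $ i $ j / sqrt (weighted_degree E W i * weighted_degree E W j))
            else 0)"

definition neighbors :: "real^'n^'n \<Rightarrow> 'n \<Rightarrow> 'n::finite set" where
  "neighbors U v = {w. U $ v $ w > 0}"

text \<open>
  A sampling strategy consists of a function \<open>hist\<close> computing the history from the list of edges
  traversed so far (in order of traversal) and a function assigning to the current vertex, the graph
  and the history a distribution on the neighbors of that vertex. It is never consulted at a vertex
  without neighbors.
\<close>

type_synonym ('n, 'h) strategy = "'n \<Rightarrow> real^'n^'n \<Rightarrow> 'h \<Rightarrow> 'n pmf"

definition sampling_strategy ::
  "real^'n^'n \<Rightarrow> (('n \<times> 'n) list \<Rightarrow> 'h) \<Rightarrow> ('n::finite, 'h) strategy \<Rightarrow> bool" where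
  "sampling_strategy U hist strat \<longleftrightarrow>
     (\<forall>v es. set es \<subseteq> {(x, y). y \<in> neighbors U x} \<longrightarrow> neighbors U v \<noteq> {} \<longrightarrow>
        set_pmf (strat v U (hist es)) \<subseteq> neighbors U v)"

definition nondegenerate ::
  "real^'n^'n \<Rightarrow> (('n \<times> 'n) list \<Rightarrow> 'h) \<Rightarrow> ('n::finite, 'h) strategy \<Rightarrow> bool" where
  "nondegenerate U hist strat \<longleftrightarrow>
     (\<forall>v es. set es \<subseteq> {(x, y). y \<in> neighbors U x} \<longrightarrow>
        (\<forall>w \<in> neighbors U v. pmf (strat v U (hist es)) w > 0))"

definition sample ::
  "('n::finite, 'h) strategy \<Rightarrow> 'n \<Rightarrow> real^'n^'n \<Rightarrow> 'h \<Rightarrow> ('n \<times> real) pmf" where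
  "sample strat v U h = map_pmf (\<lambda>w. (w, pmf (strat v U h) w)) (strat v U h)"

text \<open>
  One walk, run from the current vertex \<open>v\<close> with the current load, accumulated vector \<open>\<phi>\<close> and list
  \<open>es\<close> of edges traversed so far in the whole run; it returns the updated \<open>\<phi>\<close> and \<open>es\<close>.
  Sub-probability mass functions are used only because they admit unbounded recursion: by
  \<open>lossless_signature\<close> below no mass is lost when \<open>p_term > 0\<close>.
\<close>

partial_function (spmf) walk ::
  "real^'n^'n \<Rightarrow> (('n \<times> 'n) list \<Rightarrow> 'h) \<Rightarrow> ('n::finite, 'h) strategy \<Rightarrow> real \<Rightarrow>
   'n \<Rightarrow> real \<Rightarrow> real^'n \<Rightarrow> ('n \<times> 'n) list \<Rightarrow> ((real^'n) \<times> ('n \<times> 'n) list) spmf" where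
  "walk U hist strat p_term v load \<phi> es =
     bind_pmf (bernoulli_pmf p_term) (\<lambda>stop.
       if stop \<or> neighbors U v = {} then return_spmf (\<phi>, es)
       else bind_pmf (sample strat v U (hist es)) (\<lambda>(w, p).
         let load' = load * (U $ v $ w / (p * (1 - p_term)))
         in walk U hist strat p_term w load' (\<phi> + axis w load') (es @ [(v, w)])))"

primrec walks ::
  "real^'n^'n \<Rightarrow> (('n \<times> 'n) list \<Rightarrow> 'h) \<Rightarrow> ('n::finite, 'h) strategy \<Rightarrow> real \<Rightarrow> 'n \<Rightarrow>
   nat \<Rightarrow> real^'n \<Rightarrow> ('n \<times> 'n) list \<Rightarrow> ((real^'n) \<times> ('n \<times> 'n) list) spmf" where
  "walks U hist strat p_term i 0 \<phi> es = return_spmf (\<phi>, es)"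
| "walks U hist strat p_term i (Suc t) \<phi> es =
     bind_spmf (walk U hist strat p_term i 1 (\<phi> + axis i 1) es)
       (\<lambda>(\<phi>', es'). walks U hist strat p_term i t \<phi>' es')"

definition signature ::
  "real^'n^'n \<Rightarrow> (('n \<times> 'n) list \<Rightarrow> 'h) \<Rightarrow> ('n::finite, 'h) strategy \<Rightarrow> real \<Rightarrow> nat \<Rightarrow> 'n \<Rightarrow>
   (real^'n) spmf" where
  "signature U hist strat p_term m i =
     map_spmf (\<lambda>(\<phi>, es). (1 / real m) *\<^sub>R \<phi>) (walks U hist strat p_term i m 0 [])"

definition signature_law ::
  "real^'n^'n \<Rightarrow> (('n \<times> 'n) list \<Rightarrow> 'h) \<Rightarrow> ('n::finite, 'h) strategy \<Rightarrow> real \<Rightarrow> nat \<Rightarrow> 'n \<Rightarrow>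
   (real^'n) measure" where
  "signature_law U hist strat p_term m i =
     distr (measure_spmf (signature U hist strat p_term m i)) borel (\<lambda>x. x)"

lemma lossless_walk:
  assumes "0 < q" "q < 1"
  shows "lossless_spmf (walk U hist strat q v load \<phi> es)"
proof -
  define f where "f = (\<lambda>(v, load, \<phi>, es). weight_spmf (walk U hist strat q v load \<phi> es))"
  define c where "c = (INF s. f s)"
  have bdd: "bdd_below (range f)"
    by (rule bdd_belowI[of _ 0]) (auto simp: f_def weight_spmf_nonneg)
  have f_nonneg: "f s \<ge> 0" and f_le: "f s \<le> 1" for s
    by (auto simp: f_def weight_spmf_nonneg weight_spmf_le_1 split: prod.split)
  have c_le: "c \<le> f s" for s
    unfolding c_def by (rule cINF_lower[OF bdd]) simp
  have c_le1: "c \<le> 1" using c_le f_le order_trans by blast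
  have step: "q + (1 - q) * c \<le> f s" for s
  proof -
    obtain v load \<phi> es where s: "s = (v, load, \<phi>, es)" by (cases s)
    let ?rest = "bind_pmf (sample strat v U (hist es)) (\<lambda>(w, p).
         let load' = load * (U $ v $ w / (p * (1 - q)))
         in walk U hist strat q w load' (\<phi> + axis w load') (es @ [(v, w)]))"
    have wb: "weight_spmf (bind_pmf P g) = measure_pmf.expectation P (\<lambda>x. weight_spmf (g x))"
      for P :: "'x pmf" and g :: "'x \<Rightarrow> 'y spmf"
      using weight_bind_spmf[of "spmf_of_pmf P" g] by (simp add: o_def)
    have rest: "c \<le> weight_spmf ?rest"
    proof -
      have "c = measure_pmf.expectation (sample strat v U (hist es)) (\<lambda>_. c)" by simp
      also have "\<dots> \<le> weight_spmf ?rest" unfolding wb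
      proof (rule integral_mono)
        show "integrable (measure_pmf (sample strat v U (hist es))) (\<lambda>x. weight_spmf
          (case x of (w, p) \<Rightarrow> let load' = load * (U $ v $ w / (p * (1 - q)))
             in walk U hist strat q w load' (\<phi> + axis w load') (es @ [(v, w)])))"
          by (rule measure_pmf.integrable_const_bound[where B = 1])
             (auto simp: weight_spmf_nonneg weight_spmf_le_1)
        fix x :: "'a \<times> real"
        obtain w p where x: "x = (w, p)" by (cases x)
        define l where "l = load * (U $ v $ w / (p * (1 - q)))"
        show "c \<le> weight_spmf
          (case x of (w, p) \<Rightarrow> let load' = load * (U $ v $ w / (p * (1 - q)))
             in walk U hist strat q w load' (\<phi> + axis w load') (es @ [(v, w)]))"
          using c_le[of "(w, l, \<phi> + axis w l, es @ [(v, w)])"]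
          by (simp add: f_def x Let_def l_def)
      qed simp
      finally show ?thesis .
    qed
    have "walk U hist strat q v load \<phi> es = bind_pmf (bernoulli_pmf q) (\<lambda>stop.
        if stop \<or> neighbors U v = {} then return_spmf (\<phi>, es) else ?rest)"
      by (rule walk.simps)
    hence "f s = weight_spmf (bind_pmf (bernoulli_pmf q) (\<lambda>stop.
        if stop \<or> neighbors U v = {} then return_spmf (\<phi>, es) else ?rest))"
      by (simp only: s f_def prod.case)
    also have "\<dots> = q * 1 + (1 - q) *
        weight_spmf (if neighbors U v = {} then return_spmf (\<phi>, es) else ?rest)"
      unfolding wb using assms by simp
    finally have "f s = q * 1 + (1 - q) *
        weight_spmf (if neighbors U v = {} then return_spmf (\<phi>, es) else ?rest)" .
    moreover have "c \<le> weight_spmf (if neighbors U v = {} then return_spmf (\<phi>, es) else ?rest)"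
      using rest c_le1 by auto
    ultimately show ?thesis
      using assms by (simp add: mult_left_mono)
  qed
  have "q + (1 - q) * c \<le> c"
    unfolding c_def by (rule cINF_greatest) (use step c_def in auto)
  hence "q * 1 \<le> q * c" by (simp add: algebra_simps)
  hence "1 \<le> c" using assms by simp
  hence "1 \<le> f (v, load, \<phi>, es)" using c_le order_trans by blast
  thus ?thesis
    using f_le[of "(v, load, \<phi>, es)"] by (simp add: f_def lossless_spmf_def)
qed

lemma lossless_signature:
  assumes "0 < p_term" "p_term < 1"
  shows "lossless_spmf (signature U hist strat p_term m i)"
proof -
  have "lossless_spmf (walks U hist strat p_term i t \<phi> es)" for t \<phi> es
    by (induction t arbitrary: \<phi> es) (auto simp: lossless_bind_spmf lossless_walk[OF assms])
  thus ?thesis by (simp add: signature_def)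
qed

end

theory Submission
  imports Defs
begin

text \<open>
  With \<open>U\<close> the walk matrix, \<open>I + \<sigma>\<^sup>2 L = (\<sigma>\<^sup>2 + 1) (I - U)\<close>. The vector \<open>x\<close> of square roots of the degrees
  satisfies \<open>U x \<le> s x\<close> with \<open>s = \<sigma>\<^sup>2 / (\<sigma>\<^sup>2 + 1) < 1\<close>, so \<open>I - U\<close> is invertible with a nonnegative
  inverse \<open>R\<close>. Importance weighting makes the expected signature of \<open>i\<close> satisfy the linear recursion
  of the \<open>i\<close>-th row of \<open>R = I + U R\<close>, whatever the history. Since loads are nonnegative, fixpoint
  induction bounds the expectation from above by this solution; unfolding the recursion \<open>n\<close> times
  bounds it from below up to an error of order \<open>s\<^sup>n\<close>. Hence \<open>C\<close> has mean \<open>(I + \<sigma>\<^sup>2 L)\<^sup>-\<^sup>1\<close>, a symmetric matrix,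
  and the entries of \<open>C C'\<^sup>T\<close> are sums of products of independent variables.
\<close>

section \<open>Nonnegative integrals over sub-probability mass functions\<close>

text \<open>Lost mass sits at \<open>None\<close> and contributes 0; on the option type the
  integration rule for \<open>bind_pmf\<close> becomes available.\<close>

lemma nn_integral_measure_spmf_option:
  "(\<integral>\<^sup>+ x. f x \<partial>measure_spmf p) = (\<integral>\<^sup>+ y. (case y of None \<Rightarrow> 0 | Some x \<Rightarrow> f x) \<partial>measure_pmf p)"
  by (subst nn_integral_measure_spmf_conv_measure_pmf, simp, subst nn_integral_restrict_space)
     (auto intro!: nn_integral_cong split: option.split)

lemma nn_integral_bind_pmf_spmf:
  "(\<integral>\<^sup>+ x. f x \<partial>measure_spmf (bind_pmf P k)) = (\<integral>\<^sup>+ y. (\<integral>\<^sup>+ x. f x \<partial>measure_spmf (k y)) \<partial>measure_pmf P)"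
  by (simp add: nn_integral_measure_spmf_option)

lemma nn_integral_bind_spmf:
  "(\<integral>\<^sup>+ x. f x \<partial>measure_spmf (bind_spmf p k)) = (\<integral>\<^sup>+ y. (\<integral>\<^sup>+ x. f x \<partial>measure_spmf (k y)) \<partial>measure_spmf p)"
  by (auto simp: nn_integral_measure_spmf_option bind_spmf_def intro!: nn_integral_cong split: option.split)

lemma nn_integral_return_spmf: "(\<integral>\<^sup>+ x. f x \<partial>measure_spmf (return_spmf a)) = f a"
  by (simp add: nn_integral_measure_spmf_option)

lemma nn_integral_return_None: "(\<integral>\<^sup>+ x. f x \<partial>measure_spmf (return_pmf None)) = 0"
  by (simp add: nn_integral_measure_spmf_option)

text \<open>Monotone convergence along an arbitrary chain instead of a sequence: it is available
  because the support of the least upper bound is countable.\<close>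

lemma nn_integral_lub_spmf:
  assumes chain: "Complete_Partial_Order.chain (ord_spmf (=)) Y" and Y: "Y \<noteq> {}"
  shows "(\<integral>\<^sup>+ x. f x \<partial>measure_spmf (lub_spmf Y)) = (SUP p\<in>Y. \<integral>\<^sup>+ x. f x \<partial>measure_spmf p)"
proof -
  let ?M = "count_space (set_spmf (lub_spmf Y))"
  have "(\<integral>\<^sup>+ x. f x \<partial>measure_spmf (lub_spmf Y)) = (\<integral>\<^sup>+ x. (SUP p\<in>Y. ennreal (spmf p x) * f x) \<partial>?M)"
    by (simp add: nn_integral_measure_spmf' ennreal_spmf_lub_spmf[OF chain Y] SUP_mult_right_ennreal Y)
  also have "\<dots> = (SUP p\<in>Y. \<integral>\<^sup>+ x. ennreal (spmf p x) * f x \<partial>?M)"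
    using Y
  proof (rule nn_integral_monotone_convergence_SUP_countable)
    have "Complete_Partial_Order.chain (\<le>) ((\<lambda>g x. g x * f x) ` (\<lambda>p x. ennreal (spmf p x)) ` Y)"
      using chain_ord_spmf_eqD[OF chain]
      by (rule chain_imageI) (auto simp: le_fun_def intro!: mult_right_mono)
    thus "Complete_Partial_Order.chain (\<le>) ((\<lambda>p x. ennreal (spmf p x) * f x) ` Y)"
      by (simp add: image_image)
  qed simp
  \<comment> \<open>The support of each member of the chain lies in that of the least upper bound,
    so enlarging the counting space adds only zero terms.\<close>
  also have "\<dots> = (SUP p\<in>Y. \<integral>\<^sup>+ x. f x \<partial>measure_spmf p)"
    by (auto simp: nn_integral_measure_spmf nn_integral_count_space_indicator set_lub_spmf[OF chain]
        in_set_spmf_iff_spmf intro!: SUP_cong nn_integral_cong split: split_indicator)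
  finally show ?thesis .
qed

text \<open>Upper bounds survive suprema and hold at the bottom element, whose integral is 0.
  Positive lower bounds already fail there, so fixpoint induction can yield only one half of the
  mean formula.\<close>

lemma admissible_nn_integral_spmf:
  "ccpo.admissible lub_spmf (ord_spmf (=)) (\<lambda>p. (\<integral>\<^sup>+ x. f x \<partial>measure_spmf p) \<le> c)"
  by (rule ccpo.admissibleI) (auto simp: nn_integral_lub_spmf intro: SUP_least)

lemma admissible_set_spmf:
  "ccpo.admissible lub_spmf (ord_spmf (=)) (\<lambda>p. \<forall>x\<in>set_spmf p. Q x)"
  by (rule ccpo.admissibleI) (auto simp: set_lub_spmf)

section \<open>Matrix inverses and the nonnegative inverse of I - U\<close>

lemma matrix_diff_rdistrib:
  fixes A B C :: "real^'n^'n::finite"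
  shows "(A - B) ** C = A ** C - B ** C"
  by (vector matrix_matrix_mult_def sum_subtractf left_diff_distrib)

text \<open>\<open>matrix_inv\<close> chooses some two-sided inverse. For square matrices a right
  inverse is two-sided, and two-sided inverses are unique.\<close>

lemma matrix_inv_eqI:
  fixes A B :: "real^'n^'n::finite"
  assumes "A ** B = mat 1"
  shows "matrix_inv A = B"
proof -
  have "B ** A = mat 1" using assms matrix_left_right_inverse by blast
  hence "A ** matrix_inv A = mat 1 \<and> matrix_inv A ** A = mat 1"
    unfolding matrix_inv_def using assms by (intro someI_ex[of "\<lambda>A'. A ** A' = mat 1 \<and> A' ** A = mat 1"]) blast
  thus ?thesis by (metis \<open>B ** A = mat 1\<close> matrix_mul_assoc matrix_mul_lid matrix_mul_rid)
qed

text \<open>Perron-type minimum principle: look at a vertex minimising \<open>y / x\<close>.\<close>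

lemma supersolution_nonneg:
  fixes U :: "real^'n^'n::finite" and x y :: "'n \<Rightarrow> real"
  assumes U: "\<And>v w. 0 \<le> U $ v $ w" and x: "\<And>v. 0 < x v" and s: "s < 1"
    and contr: "\<And>v. (\<Sum>w\<in>UNIV. U $ v $ w * x w) \<le> s * x v"
    and super: "\<And>v. (\<Sum>w\<in>UNIV. U $ v $ w * y w) \<le> y v"
  shows "0 \<le> y v"
proof -
  define c where "c = Min (range (\<lambda>v. y v / x v))"
  have "c \<in> range (\<lambda>v. y v / x v)" unfolding c_def by (rule Min_in) auto
  then obtain u where u: "c = y u / x u" by blast
  have c_le: "c * x w \<le> y w" for w
  proof -
    have "c \<le> y w / x w" unfolding c_def by (rule Min_le) auto
    thus ?thesis using x[of w] by (simp add: field_simps)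
  qed
  have "c \<ge> 0"
  proof (rule ccontr)
    assume "\<not> c \<ge> 0"
    hence c: "c < 0" by simp
    \<comment> \<open>Because c < 0, the contraction bound at the minimiser u is reversed. The chain
      ends in s >= 1 after cancelling the negative factor \<open>c * x u\<close>.\<close>
    have "c * (s * x u) \<le> c * (\<Sum>w\<in>UNIV. U $ u $ w * x w)"
      using c contr[of u] by (simp add: mult_left_mono_neg)
    also have "\<dots> = (\<Sum>w\<in>UNIV. U $ u $ w * (c * x w))"
      by (simp add: sum_distrib_left mult_ac)
    also have "\<dots> \<le> (\<Sum>w\<in>UNIV. U $ u $ w * y w)"
      by (intro sum_mono mult_left_mono c_le U)
    also have "\<dots> \<le> y u" by (rule super)
    also have "\<dots> = c * x u" using x[of u] u by simp
    finally have "c * x u * s \<le> c * x u * 1" by (simp add: mult_ac)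
    moreover have "c * x u < 0" using c x[of u] by (simp add: mult_neg_pos)
    ultimately show False using s by (simp only: mult_le_cancel_left_neg)
  qed
  hence "0 \<le> c * x v" using x[of v] by simp
  thus ?thesis using c_le[of v] by linarith
qed

text \<open>A kernel vector y satisfies \<open>U *v y = y\<close>, so the minimum principle applies
  to both y and -y and forces y = 0. A column of the inverse exceeds its image under U by a column
  of the identity, hence is a supersolution.\<close>

lemma
  fixes U :: "real^'n^'n::finite" and x :: "'n \<Rightarrow> real"
  assumes U: "\<And>v w. 0 \<le> U $ v $ w" and x: "\<And>v. 0 < x v" and s: "s < 1"
    and contr: "\<And>v. (\<Sum>w\<in>UNIV. U $ v $ w * x w) \<le> s * x v"
  shows invertible_one_minus: "invertible (mat 1 - U)"
    and matrix_inv_one_minus_nonneg: "0 \<le> matrix_inv (mat 1 - U) $ i $ j"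
proof -
  note nonneg = supersolution_nonneg[of U x s, OF U x s contr]
  have ker: "y = 0" if "(mat 1 - U) *v y = 0" for y
  proof -
    have *: "(\<Sum>w\<in>UNIV. U $ v $ w * y $ w) = y $ v" for v
    proof -
      have "U *v y = y" using that by (simp add: matrix_vector_mult_diff_rdistrib)
      from arg_cong[OF this, of "\<lambda>y. y $ v"] show ?thesis by (simp add: matrix_vector_mult_def)
    qed
    have "0 \<le> y $ v" "0 \<le> - y $ v" for v
      using nonneg[of "\<lambda>v. y $ v" v] nonneg[of "\<lambda>v. - y $ v" v] * by (simp_all add: sum_negf)
    thus "y = 0" by (simp add: vec_eq_iff) (metis antisym neg_0_le_iff_le)
  qed
  then obtain B where B: "B ** (mat 1 - U) = mat 1"
    using matrix_left_invertible_ker[of "mat 1 - U"] by blast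
  thus inv: "invertible (mat 1 - U)"
    unfolding invertible_def using matrix_left_right_inverse by blast
  have "(mat 1 - U) ** matrix_inv (mat 1 - U) = mat 1"
    using inv matrix_inv_eqI unfolding invertible_def by metis
  hence "matrix_inv (mat 1 - U) - U ** matrix_inv (mat 1 - U) = mat 1"
    by (simp add: matrix_diff_rdistrib)
  hence "(matrix_inv (mat 1 - U) - U ** matrix_inv (mat 1 - U)) $ v $ j = mat 1 $ v $ j" for v
    by simp
  hence *: "matrix_inv (mat 1 - U) $ v $ j
      - (\<Sum>w\<in>UNIV. U $ v $ w * matrix_inv (mat 1 - U) $ w $ j) = (if v = j then 1 else 0)" for v
    by (simp add: matrix_matrix_mult_def mat_def)
  show "0 \<le> matrix_inv (mat 1 - U) $ i $ j"
    by (rule nonneg) (use * in \<open>smt (verit)\<close>)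
qed

section \<open>Fixpoint induction and single moves of the walk\<close>

text \<open>\<open>Q\<close> depends on vertex, load, vector and history because the recursive call
  changes all four; the hypothesis on \<open>K\<close> must therefore cover all their
  values.\<close>

lemma walk_induct:
  assumes "\<And>v l \<phi> es. ccpo.admissible lub_spmf (ord_spmf (=)) (Q v l \<phi> es)"
    and "\<And>v l \<phi> es. Q v l \<phi> es (return_pmf None)"
    and "\<And>K v l \<phi> es. (\<And>v l \<phi> es. Q v l \<phi> es (K v l \<phi> es)) \<Longrightarrow>
      Q v l \<phi> es (bind_pmf (bernoulli_pmf q) (\<lambda>stop.
        if stop \<or> neighbors U v = {} then return_spmf (\<phi>, es)
        else bind_pmf (sample strat v U (hist es)) (\<lambda>(w, p).
          let l' = l * (U $ v $ w / (p * (1 - q))) in K w l' (\<phi> + axis w l') (es @ [(v, w)]))))"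
  shows "Q v l \<phi> es (walk U hist strat q v l \<phi> es)"
proof -
  have "\<forall>v l \<phi> es. Q v l \<phi> es (walk U hist strat q v l \<phi> es)"
  proof (rule walk.fixp_induct, goal_cases)
    case 1
    show ?case
      unfolding curry_def
      by (intro admissible_all admissible_subst[OF assms(1)] mcont_call)
  next
    case 2
    show ?case using assms(2) by blast
  next
    case (3 K)
    show ?case by (intro allI assms(3)) (use 3 in blast)
  qed
  thus ?thesis by blast
qed

locale random_walk =
  fixes U :: "real^'n^'n::finite" and hist :: "('n \<times> 'n) list \<Rightarrow> 'h"
    and strat :: "('n, 'h) strategy" and q :: real
  assumes q: "0 < q" "q < 1"
    and U_nonneg: "0 \<le> U $ v $ w"
    and sampling: "sampling_strategy U hist strat"
    and nondeg: "nondegenerate U hist strat"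
begin

text \<open>The strategy is constrained only on histories made of edges of the graph, so this
  condition is carried along as an invariant.\<close>

abbreviation traversed :: "('n \<times> 'n) list \<Rightarrow> bool" where
  "traversed es \<equiv> set es \<subseteq> {(x, y). y \<in> neighbors U x}"

definition next_load :: "'n \<Rightarrow> real \<Rightarrow> ('n \<times> 'n) list \<Rightarrow> 'n \<Rightarrow> real" where
  "next_load v l es w = l * (U $ v $ w / (pmf (strat v U (hist es)) w * (1 - q)))"

text \<open>One unfolding of \<open>walk\<close> with the recursive call abstracted:
  \<open>K\<close> is an approximation in fixpoint induction and \<open>walk\<close> itself in the
  lower bound.\<close>

definition move where
  "move K v l \<phi> es = bind_pmf (bernoulli_pmf q) (\<lambda>stop.
     if stop \<or> neighbors U v = {} then return_spmf (\<phi>, es)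
     else bind_pmf (sample strat v U (hist es)) (\<lambda>(w, p).
       let l' = l * (U $ v $ w / (p * (1 - q)))
       in K w l' (\<phi> + axis w l') (es @ [(v, w)])))"

lemma walk_move: "walk U hist strat q v l \<phi> es = move (walk U hist strat q) v l \<phi> es"
  unfolding move_def by (rule walk.simps)

text \<open>\<open>sampling_strategy\<close> gives one inclusion and non-degeneracy the other.
  Expectations over the next vertex thus become finite sums over the neighbors.\<close>

lemma set_strat:
  assumes "traversed es" "neighbors U v \<noteq> {}"
  shows "set_pmf (strat v U (hist es)) = neighbors U v"
  using assms sampling nondeg
  unfolding sampling_strategy_def nondegenerate_def set_pmf_eq' by blast

lemma next_load_nonneg: "0 \<le> l \<Longrightarrow> 0 \<le> next_load v l es w"
  using U_nonneg[of v w] q by (simp add: next_load_def)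

lemma nn_integral_move:
  assumes es: "traversed es"
  shows "(\<integral>\<^sup>+ x. f x \<partial>measure_spmf (move K v l \<phi> es)) =
    ennreal q * f (\<phi>, es) + ennreal (1 - q) * (if neighbors U v = {} then f (\<phi>, es) else
      (\<Sum>w\<in>neighbors U v. ennreal (pmf (strat v U (hist es)) w) *
         (\<integral>\<^sup>+ x. f x \<partial>measure_spmf
           (K w (next_load v l es w) (\<phi> + axis w (next_load v l es w)) (es @ [(v, w)])))))"
proof -
  have "(\<integral>\<^sup>+ x. f x \<partial>measure_spmf (move K v l \<phi> es)) =
      f (\<phi>, es) * ennreal q + (if neighbors U v = {} then f (\<phi>, es) else
      (\<integral>\<^sup>+ w. (\<integral>\<^sup>+ x. f x \<partial>measure_spmf
           (K w (next_load v l es w) (\<phi> + axis w (next_load v l es w)) (es @ [(v, w)])))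
         \<partial>measure_pmf (strat v U (hist es)))) * ennreal (1 - q)"
    using q
    by (auto simp: move_def nn_integral_bind_pmf_spmf nn_integral_bernoulli_pmf nn_integral_return_spmf
        sample_def Let_def next_load_def)
  thus ?thesis
    using set_strat[OF es, of v] by (simp add: nn_integral_measure_pmf_finite mult_ac)
qed

lemma set_spmf_move:
  assumes es: "traversed es" and x: "x \<in> set_spmf (move K v l \<phi> es)"
  shows "x = (\<phi>, es) \<or> (\<exists>w\<in>neighbors U v.
    x \<in> set_spmf (K w (next_load v l es w) (\<phi> + axis w (next_load v l es w)) (es @ [(v, w)])))"
  using x set_strat[OF es, of v]
  by (auto simp: move_def next_load_def set_spmf_bind_pmf sample_def Let_def bind_UNION split: if_splits)

text \<open>Coordinates never decrease because loads stay nonnegative; the second half lets the next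
  walk of the run start from a legal history.\<close>

lemma walk_invariant:
  assumes "0 \<le> l" "traversed es" and x: "x \<in> set_spmf (walk U hist strat q v l \<phi> es)"
  shows "\<phi> $ j \<le> fst x $ j \<and> traversed (snd x)"
proof -
  have "0 \<le> l \<longrightarrow> traversed es \<longrightarrow>
     (\<forall>x\<in>set_spmf (walk U hist strat q v l \<phi> es). \<phi> $ j \<le> fst x $ j \<and> traversed (snd x))"
  proof (rule walk_induct[where Q = "\<lambda>v l \<phi> es p. 0 \<le> l \<longrightarrow> traversed es \<longrightarrow>
      (\<forall>x\<in>set_spmf p. \<phi> $ j \<le> fst x $ j \<and> traversed (snd x))"], goal_cases)
    case 1
    show ?case by (intro admissible_imp admissible_set_spmf)
  next
    case 2
    show ?case by simp
  next
    case (3 K v l \<phi> es)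
    show ?case
    proof (intro impI ballI, fold move_def)
      fix x
      assume l: "0 \<le> l" and es: "traversed es" and x: "x \<in> set_spmf (move K v l \<phi> es)"
      from set_spmf_move[OF es x] show "\<phi> $ j \<le> fst x $ j \<and> traversed (snd x)"
      proof (elim disjE bexE)
        assume "x = (\<phi>, es)"
        thus ?thesis using es by simp
      next
        fix w
        let ?l = "next_load v l es w"
        assume w: "w \<in> neighbors U v"
          and x: "x \<in> set_spmf (K w ?l (\<phi> + axis w ?l) (es @ [(v, w)]))"
        have "(\<phi> + axis w ?l) $ j \<le> fst x $ j \<and> traversed (snd x)"
          using 3[of ?l "es @ [(v, w)]" w "\<phi> + axis w ?l"] next_load_nonneg[OF l, of v es w] es w x
          by auto
        thus ?thesis using next_load_nonneg[OF l, of v es w] by (auto simp: axis_def split: if_splits)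
      qed
    qed
  qed
  thus ?thesis using assms by blast
qed

text \<open>The division by \<open>p (1 - q)\<close> in the load cancels the probability of the transition.\<close>

lemma move_mean:
  assumes es: "traversed es"
  shows "q * \<phi> $ j + (1 - q) * (if neighbors U v = {} then \<phi> $ j else
      (\<Sum>w\<in>neighbors U v. pmf (strat v U (hist es)) w *
         ((\<phi> + axis w (next_load v l es w)) $ j + next_load v l es w * H w)))
    = \<phi> $ j + l * (\<Sum>w\<in>UNIV. U $ v $ w * ((if w = j then 1 else 0) + H w))"
proof -
  let ?P = "pmf (strat v U (hist es))"
  let ?c = "\<lambda>w. (if w = j then 1 else 0) + H w"
  have zero: "U $ v $ w = 0" if "w \<notin> neighbors U v" for w
    using that U_nonneg[of v w] by (simp add: neighbors_def)
  have sum: "(\<Sum>w\<in>UNIV. U $ v $ w * ?c w) = (\<Sum>w\<in>neighbors U v. U $ v $ w * ?c w)"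
    by (rule sum.mono_neutral_right) (auto simp: zero)
  show ?thesis
  proof (cases "neighbors U v = {}")
    \<comment> \<open>Stopping at a dead end agrees with the recursion, since row v of U is then
      zero.\<close>
    case True
    thus ?thesis by (simp only: sum) (simp add: algebra_simps)
  next
    case False
    have one: "(\<Sum>w\<in>neighbors U v. ?P w) = 1"
      by (rule sum_pmf_eq_1) (use set_strat[OF es False] in auto)
    have "(1 - q) * (?P w * ((\<phi> + axis w (next_load v l es w)) $ j + next_load v l es w * H w))
        = (1 - q) * \<phi> $ j * ?P w + l * (U $ v $ w * ?c w)" if "w \<in> neighbors U v" for w
    proof -
      have "?P w > 0" using nondeg es that unfolding nondegenerate_def by blast
      hence cancel: "(1 - q) * ?P w * next_load v l es w = l * U $ v $ w"
        using q by (simp add: next_load_def)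
      have "(1 - q) * (?P w * ((\<phi> + axis w (next_load v l es w)) $ j + next_load v l es w * H w))
          = (1 - q) * \<phi> $ j * ?P w + (1 - q) * ?P w * next_load v l es w * ?c w"
        by (simp add: axis_def algebra_simps)
      thus ?thesis unfolding cancel by (simp only: mult.assoc)
    qed
    hence "(1 - q) * (\<Sum>w\<in>neighbors U v. ?P w *
         ((\<phi> + axis w (next_load v l es w)) $ j + next_load v l es w * H w))
       = (\<Sum>w\<in>neighbors U v. (1 - q) * \<phi> $ j * ?P w + l * (U $ v $ w * ?c w))"
      unfolding sum_distrib_left by (intro sum.cong) auto
    also have "\<dots> = (1 - q) * \<phi> $ j + l * (\<Sum>w\<in>neighbors U v. U $ v $ w * ?c w)"
      using one by (simp add: sum.distrib flip: sum_distrib_left)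
    finally have "(1 - q) * (\<Sum>w\<in>neighbors U v. ?P w *
         ((\<phi> + axis w (next_load v l es w)) $ j + next_load v l es w * H w))
       = (1 - q) * \<phi> $ j + l * (\<Sum>w\<in>UNIV. U $ v $ w * ?c w)"
      by (simp only: sum)
    thus ?thesis using False by (simp only: if_False) (simp add: left_diff_distrib)
  qed
qed

text \<open>The left-hand side may contain negative terms, which \<open>ennreal\<close> truncates to 0.\<close>

lemma ennreal_move_le:
  assumes "0 \<le> b"
  shows "ennreal (q * b + (1 - q) * (if neighbors U v = {} then b else
      (\<Sum>w\<in>neighbors U v. pmf P w * a w)))
    \<le> ennreal q * ennreal b + ennreal (1 - q) * (if neighbors U v = {} then ennreal b else
      (\<Sum>w\<in>neighbors U v. ennreal (pmf P w) * ennreal (a w)))" (is "ennreal ?l \<le> ?r")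
proof -
  have "?l \<le> q * b + (1 - q) * (if neighbors U v = {} then b else
      (\<Sum>w\<in>neighbors U v. pmf P w * max 0 (a w)))"
    using q by (intro add_left_mono mult_left_mono if_mono sum_mono) (auto intro!: sum_mono mult_left_mono)
  hence "ennreal ?l \<le> ennreal (q * b + (1 - q) * (if neighbors U v = {} then b else
      (\<Sum>w\<in>neighbors U v. pmf P w * max 0 (a w))))" by (rule ennreal_leI)
  also have "\<dots> = ?r"
    using q assms by (auto simp: ennreal_plus ennreal_mult sum_nonneg simp flip: sum_ennreal)
  finally show ?thesis .
qed

text \<open>Nonnegative summands exclude truncation, so here the comparison is an equation.\<close>

lemma ennreal_move_eq:
  assumes "0 \<le> b" "\<And>w. w \<in> neighbors U v \<Longrightarrow> 0 \<le> a w"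
  shows "ennreal q * ennreal b + ennreal (1 - q) * (if neighbors U v = {} then ennreal b else
      (\<Sum>w\<in>neighbors U v. ennreal (pmf P w) * ennreal (a w)))
    = ennreal (q * b + (1 - q) * (if neighbors U v = {} then b else
      (\<Sum>w\<in>neighbors U v. pmf P w * a w)))"
  using q assms by (auto simp: ennreal_plus ennreal_mult sum_nonneg simp flip: sum_ennreal)

section \<open>Expected value of one walk\<close>

abbreviation mean_walk :: "'n \<Rightarrow> 'n \<Rightarrow> real \<Rightarrow> real^'n \<Rightarrow> ('n \<times> 'n) list \<Rightarrow> ennreal" where
  "mean_walk j v l \<phi> es \<equiv> (\<integral>\<^sup>+ x. ennreal (fst x $ j) \<partial>measure_spmf (walk U hist strat q v l \<phi> es))"

text \<open>\<open>H v\<close> is meant as the expected load still to be added at j from v with load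
  1; the visit to v itself is already contained in \<phi>. The claim is affine in the load, which
  lets \<open>move_mean\<close> close the induction.\<close>

lemma mean_walk_upper:
  assumes H: "\<And>v. 0 \<le> H v" "\<And>v. H v = (\<Sum>w\<in>UNIV. U $ v $ w * ((if w = j then 1 else 0) + H w))"
    and valid: "0 \<le> l" "0 \<le> \<phi> $ j" "traversed es"
  shows "mean_walk j v l \<phi> es \<le> ennreal (\<phi> $ j + l * H v)"
proof -
  have "0 \<le> l \<longrightarrow> 0 \<le> \<phi> $ j \<longrightarrow> traversed es \<longrightarrow> mean_walk j v l \<phi> es \<le> ennreal (\<phi> $ j + l * H v)"
  proof (rule walk_induct[where Q = "\<lambda>v l \<phi> es p. 0 \<le> l \<longrightarrow> 0 \<le> \<phi> $ j \<longrightarrow> traversed es \<longrightarrow>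
      (\<integral>\<^sup>+ x. ennreal (fst x $ j) \<partial>measure_spmf p) \<le> ennreal (\<phi> $ j + l * H v)"], goal_cases)
    case 1
    show ?case by (intro admissible_imp admissible_nn_integral_spmf)
  next
    case 2
    show ?case by (simp add: nn_integral_return_None)
  next
    case (3 K v l \<phi> es)
    show ?case
    proof (intro impI, fold move_def)
      assume l: "0 \<le> l" and \<phi>: "0 \<le> \<phi> $ j" and es: "traversed es"
      let ?l = "next_load v l es"
      have l': "0 \<le> ?l w" for w by (rule next_load_nonneg[OF l])
      have \<phi>': "0 \<le> (\<phi> + axis w (?l w)) $ j" for w
        using \<phi> l' by (auto simp: axis_def)
      have "(\<integral>\<^sup>+ x. ennreal (fst x $ j) \<partial>measure_spmf (move K v l \<phi> es))
        \<le> ennreal q * ennreal (\<phi> $ j) + ennreal (1 - q) * (if neighbors U v = {} then ennreal (\<phi> $ j) else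
          (\<Sum>w\<in>neighbors U v. ennreal (pmf (strat v U (hist es)) w) *
             ennreal ((\<phi> + axis w (?l w)) $ j + ?l w * H w)))"
        unfolding nn_integral_move[OF es] fst_conv
        using 3 es l' \<phi>'
        by (auto intro!: add_left_mono mult_left_mono sum_mono simp del: vector_add_component)
      also have "\<dots> = ennreal (\<phi> $ j + l * (\<Sum>w\<in>UNIV. U $ v $ w * ((if w = j then 1 else 0) + H w)))"
        using \<phi> l' \<phi>' H(1)
        by (subst ennreal_move_eq) (auto simp: move_mean[OF es] simp del: vector_add_component)
      finally show "(\<integral>\<^sup>+ x. ennreal (fst x $ j) \<partial>measure_spmf (move K v l \<phi> es)) \<le> ennreal (\<phi> $ j + l * H v)"
        by (simp only: H(2)[symmetric])
    qed
  qed
  thus ?thesis using valid by blast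
qed

text \<open>
  A walk only adds nonnegative loads, so its mean is at least \<open>\<phi> + l * (H - k * x)\<close> for large \<open>k\<close>;
  each unfolding of one move shrinks the defect \<open>k\<close> by the factor \<open>s\<close>.
\<close>

lemma mean_walk_lower:
  assumes x: "\<And>v. 0 < x v" and s: "0 \<le> s"
    and contr: "\<And>v. (\<Sum>w\<in>UNIV. U $ v $ w * x w) \<le> s * x v"
    and H: "\<And>v. H v = (\<Sum>w\<in>UNIV. U $ v $ w * ((if w = j then 1 else 0) + H w))"
    and k: "\<And>v. H v \<le> k * x v" "0 \<le> k"
    and valid: "0 \<le> l" "0 \<le> \<phi> $ j" "traversed es"
  shows "ennreal (\<phi> $ j + l * (H v - k * s ^ n * x v)) \<le> mean_walk j v l \<phi> es"
  using valid
proof (induction n arbitrary: v l \<phi> es)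
  case 0
  \<comment> \<open>For n = 0 the choice of k makes the bracket nonpositive, so the bound lies below
    the starting value, which the walk never undercuts. Losslessness lets that constant integrate to
    itself.\<close>
  have "ennreal (\<phi> $ j + l * (H v - k * s ^ 0 * x v)) \<le> ennreal (\<phi> $ j)"
    using 0 k(1)[of v] by (intro ennreal_leI) (simp add: mult_nonneg_nonpos)
  also have "\<dots> = (\<integral>\<^sup>+ _. ennreal (\<phi> $ j) \<partial>measure_spmf (walk U hist strat q v l \<phi> es))"
    using lossless_walk[OF q, of U hist strat v l \<phi> es]
    by (simp add: measure_spmf.emeasure_eq_measure lossless_spmf_def weight_spmf_def)
  also have "\<dots> \<le> mean_walk j v l \<phi> es"
    using walk_invariant[OF 0(1,3)] by (intro nn_integral_mono_AE) (simp add: ennreal_leI)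
  finally show ?case .
next
  case (Suc n)
  let ?l = "next_load v l es" and ?H = "\<lambda>v. H v - k * s ^ n * x v"
  have l': "0 \<le> ?l w" for w by (rule next_load_nonneg[OF Suc.prems(1)])
  have \<phi>': "0 \<le> (\<phi> + axis w (?l w)) $ j" for w
    using Suc.prems l' by (auto simp: axis_def)
  have "(\<Sum>w\<in>UNIV. U $ v $ w * ((if w = j then 1 else 0) + ?H w))
      = (\<Sum>w\<in>UNIV. U $ v $ w * ((if w = j then 1 else 0) + H w) - k * s ^ n * (U $ v $ w * x w))"
    by (intro sum.cong refl) (simp only: right_diff_distrib distrib_left add_diff_eq mult_ac)
  also have "\<dots> = H v - k * s ^ n * (\<Sum>w\<in>UNIV. U $ v $ w * x w)"
    by (simp only: sum_subtractf H[symmetric] sum_distrib_left)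
  finally have "(\<Sum>w\<in>UNIV. U $ v $ w * ((if w = j then 1 else 0) + ?H w))
      = H v - k * s ^ n * (\<Sum>w\<in>UNIV. U $ v $ w * x w)" .
  \<comment> \<open>The gain of one factor s: applying U to the defect \<open>k * s ^ n * x\<close>
    is bounded by the contraction.\<close>
  moreover have "k * s ^ n * (\<Sum>w\<in>UNIV. U $ v $ w * x w) \<le> k * s ^ n * (s * x v)"
    using contr s k(2) by (intro mult_left_mono) auto
  ultimately have "H v - k * s ^ Suc n * x v
      \<le> (\<Sum>w\<in>UNIV. U $ v $ w * ((if w = j then 1 else 0) + ?H w))"
    by (simp add: mult_ac)
  hence "ennreal (\<phi> $ j + l * (H v - k * s ^ Suc n * x v)) \<le>
      ennreal (\<phi> $ j + l * (\<Sum>w\<in>UNIV. U $ v $ w * ((if w = j then 1 else 0) + ?H w)))"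
    using Suc.prems by (intro ennreal_leI add_left_mono mult_left_mono)
  \<comment> \<open>\<open>?H\<close> may be negative, hence an inequality instead of
    \<open>ennreal_move_eq\<close>.\<close>
  also have "\<dots> \<le> ennreal q * ennreal (\<phi> $ j) + ennreal (1 - q) * (if neighbors U v = {} then ennreal (\<phi> $ j) else
          (\<Sum>w\<in>neighbors U v. ennreal (pmf (strat v U (hist es)) w) *
             ennreal ((\<phi> + axis w (?l w)) $ j + ?l w * ?H w)))"
    unfolding move_mean[OF Suc.prems(3), symmetric] by (rule ennreal_move_le[OF Suc.prems(2)])
  also have "\<dots> \<le> (\<integral>\<^sup>+ x. ennreal (fst x $ j) \<partial>measure_spmf (move (walk U hist strat q) v l \<phi> es))"
    unfolding nn_integral_move[OF Suc.prems(3)] fst_conv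
    using Suc.prems l' \<phi>'
    by (auto intro!: add_left_mono mult_left_mono sum_mono Suc.IH simp del: vector_add_component)
  finally show ?case by (simp only: walk_move[symmetric])
qed

text \<open>The lower bounds converge to the upper bound because \<open>s ^ n\<close> tends to
  0.\<close>

lemma mean_walk_eq:
  assumes x: "\<And>v. 0 < x v" and s: "0 \<le> s" "s < 1"
    and contr: "\<And>v. (\<Sum>w\<in>UNIV. U $ v $ w * x w) \<le> s * x v"
    and H: "\<And>v. 0 \<le> H v" "\<And>v. H v = (\<Sum>w\<in>UNIV. U $ v $ w * ((if w = j then 1 else 0) + H w))"
    and valid: "0 \<le> l" "0 \<le> \<phi> $ j" "traversed es"
  shows "mean_walk j v l \<phi> es = ennreal (\<phi> $ j + l * H v)"
proof (rule antisym)
  show "mean_walk j v l \<phi> es \<le> ennreal (\<phi> $ j + l * H v)"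
    by (rule mean_walk_upper[OF H valid])
  \<comment> \<open>All ratios are nonnegative, so their sum is a common bound for each of
    them.\<close>
  define k where "k = (\<Sum>v\<in>UNIV. H v / x v)"
  have "0 \<le> H v / x v" for v using x[of v] H(1)[of v] by simp
  hence "H v / x v \<le> k" for v unfolding k_def by (intro member_le_sum) auto
  hence k: "H v \<le> k * x v" for v using x by (simp add: pos_divide_le_eq)
  have k0: "0 \<le> k" unfolding k_def using \<open>\<And>v. 0 \<le> H v / x v\<close> by (intro sum_nonneg)
  have "(\<lambda>n. \<phi> $ j + l * (H v - k * s ^ n * x v)) \<longlonglongrightarrow> \<phi> $ j + l * (H v - k * 0 * x v)"
    by (intro tendsto_intros LIMSEQ_power_zero) (use s in auto)
  hence "(\<lambda>n. ennreal (\<phi> $ j + l * (H v - k * s ^ n * x v))) \<longlonglongrightarrow> ennreal (\<phi> $ j + l * H v)"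
    by (intro tendsto_ennrealI) simp
  thus "ennreal (\<phi> $ j + l * H v) \<le> mean_walk j v l \<phi> es"
    by (rule LIMSEQ_le_const2) (use mean_walk_lower[OF x s(1) contr H(2) k k0 valid] in blast)
qed

section \<open>Expected signature over all walks of a run\<close>

lemma walks_invariant:
  assumes "traversed es" and "x \<in> set_spmf (walks U hist strat q i t \<phi> es)"
  shows "\<phi> $ j \<le> fst x $ j"
  using assms
proof (induction t arbitrary: \<phi> es)
  case (Suc t)
  then obtain y where y: "y \<in> set_spmf (walk U hist strat q i 1 (\<phi> + axis i 1) es)"
    and x: "x \<in> set_spmf (walks U hist strat q i t (fst y) (snd y))"
    by (auto simp: set_bind_spmf bind_UNION)
  have "(\<phi> + axis i 1) $ j \<le> fst y $ j" "traversed (snd y)"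
    using walk_invariant[OF _ Suc.prems(1) y] by auto
  moreover have "fst y $ j \<le> fst x $ j" by (rule Suc.IH[OF _ x]) fact
  moreover have "\<phi> $ j \<le> (\<phi> + axis i 1) $ j" by (simp add: axis_def)
  ultimately show ?case by linarith
qed simp

text \<open>The walks of a run depend on each other through the history, but the mean added by a
  walk is the same for every legal history, so the contributions simply add up. The indicator is the
  initial visit to i.\<close>

lemma mean_walks_eq:
  assumes x: "\<And>v. 0 < x v" and s: "0 \<le> s" "s < 1"
    and contr: "\<And>v. (\<Sum>w\<in>UNIV. U $ v $ w * x w) \<le> s * x v"
    and H: "\<And>v. 0 \<le> H v" "\<And>v. H v = (\<Sum>w\<in>UNIV. U $ v $ w * ((if w = j then 1 else 0) + H w))"
    and valid: "0 \<le> \<phi> $ j" "traversed es"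
  shows "(\<integral>\<^sup>+ x. ennreal (fst x $ j) \<partial>measure_spmf (walks U hist strat q i t \<phi> es))
    = ennreal (\<phi> $ j + real t * ((if i = j then 1 else 0) + H i))"
  using valid
proof (induction t arbitrary: \<phi> es)
  case 0
  show ?case by (simp add: nn_integral_return_spmf)
next
  case (Suc t)
  let ?c = "(if i = j then 1 else 0) + H i" and ?M = "measure_spmf (walk U hist strat q i 1 (\<phi> + axis i 1) es)"
  have c: "0 \<le> ?c" using H(1)[of i] by simp
  have \<phi>: "0 \<le> (\<phi> + axis i 1) $ j" using Suc.prems by (simp add: axis_def)
  have inv: "0 \<le> fst y $ j" "traversed (snd y)"
    if "y \<in> set_spmf (walk U hist strat q i 1 (\<phi> + axis i 1) es)" for y
    using walk_invariant[OF _ Suc.prems(2) that, of j] \<phi> by auto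
  have "(\<integral>\<^sup>+ x. ennreal (fst x $ j) \<partial>measure_spmf (walks U hist strat q i (Suc t) \<phi> es))
      = (\<integral>\<^sup>+ y. ennreal (fst y $ j + real t * ?c) \<partial>?M)"
    using Suc.IH inv by (auto simp: nn_integral_bind_spmf split_def intro!: nn_integral_cong_AE)
  also have "\<dots> = (\<integral>\<^sup>+ y. ennreal (fst y $ j) + ennreal (real t * ?c) \<partial>?M)"
    using inv c by (intro nn_integral_cong_AE) (auto simp: ennreal_plus simp del: ennreal_plus[symmetric])
  also have "\<dots> = mean_walk j i 1 (\<phi> + axis i 1) es + ennreal (real t * ?c)"
    using lossless_walk[OF q, of U hist strat i 1 "\<phi> + axis i 1" es]
    by (subst nn_integral_add)
       (auto simp: measure_spmf.emeasure_eq_measure lossless_spmf_def weight_spmf_def)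
  also have "\<dots> = ennreal ((\<phi> + axis i 1) $ j + H i) + ennreal (real t * ?c)"
    by (subst mean_walk_eq[OF x s contr H _ \<phi> Suc.prems(2)]) auto
  also have "\<dots> = ennreal ((\<phi> + axis i 1) $ j + H i + real t * ?c)"
    using \<phi> H(1)[of i] c by (intro ennreal_plus[symmetric]) auto
  also have "(\<phi> + axis i 1) $ j + H i + real t * ?c = \<phi> $ j + real (Suc t) * ?c"
    by (simp add: axis_def algebra_simps)
  finally show ?case .
qed

text \<open>Division by m averages m equal contributions. Nonnegative coordinates with a finite
  extended-valued mean are integrable.\<close>

lemma has_bochner_integral_signature_law:
  assumes x: "\<And>v. 0 < x v" and s: "0 \<le> s" "s < 1"
    and contr: "\<And>v. (\<Sum>w\<in>UNIV. U $ v $ w * x w) \<le> s * x v"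
    and H: "\<And>v. 0 \<le> H v" "\<And>v. H v = (\<Sum>w\<in>UNIV. U $ v $ w * ((if w = j then 1 else 0) + H w))"
    and m: "1 \<le> m"
  shows "has_bochner_integral (signature_law U hist strat q m i) (\<lambda>y. y $ j) ((if i = j then 1 else 0) + H i)"
proof -
  let ?c = "(if i = j then 1 else 0) + H i" and ?W = "walks U hist strat q i m 0 []"
  have "(\<integral>\<^sup>+ y. ennreal (y $ j) \<partial>measure_spmf (signature U hist strat q m i))
      = (\<integral>\<^sup>+ y. ennreal (1 / real m) * ennreal (fst y $ j) \<partial>measure_spmf ?W)"
    using walks_invariant[of "[]" _ i m 0 j]
    by (auto simp: signature_def split_def divide_simps simp flip: ennreal_mult intro!: nn_integral_cong_AE)
  also have "\<dots> = ennreal (1 / real m) * ennreal (real m * ?c)"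
    by (subst nn_integral_cmult) (simp_all add: mean_walks_eq[OF x s contr H])
  also have "\<dots> = ennreal ?c"
    using H(1)[of i] m by (simp flip: ennreal_mult)
  finally have "(\<integral>\<^sup>+ y. ennreal (y $ j) \<partial>measure_spmf (signature U hist strat q m i)) = ennreal ?c" .
  moreover have "AE y in measure_spmf (signature U hist strat q m i). 0 \<le> y $ j"
    using walks_invariant[of "[]" _ i m 0 j] by (auto simp: signature_def)
  moreover have "0 \<le> ?c" using H(1)[of i] by simp
  ultimately have "has_bochner_integral (measure_spmf (signature U hist strat q m i)) (\<lambda>y. y $ j) ?c"
    by (intro has_bochner_integral_nn_integral) auto
  thus ?thesis
    unfolding signature_law_def has_bochner_integral_iff
    by (simp add: integrable_distr_eq integral_distr borel_measurable_continuous_onI continuous_intros)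
qed

end

text \<open>A vector is the finite sum of its coordinates under the bounded linear embeddings
  \<open>axis i\<close>.\<close>

lemma has_bochner_integral_vec:
  fixes f :: "'a \<Rightarrow> 'b::euclidean_space^'n::finite"
  assumes "\<And>i. has_bochner_integral M (\<lambda>\<omega>. f \<omega> $ i) (x $ i)"
  shows "has_bochner_integral M f x"
proof -
  have lin: "bounded_linear (axis i :: 'b \<Rightarrow> 'b^'n)" for i
    by (simp add: linear_iff axis_def vec_eq_iff flip: linear_conv_bounded_linear)
  have eq: "y = (\<Sum>i\<in>UNIV. axis i (y $ i))" for y :: "'b^'n"
    by (simp add: vec_eq_iff axis_def)
  have "has_bochner_integral M (\<lambda>\<omega>. \<Sum>i\<in>UNIV. axis i (f \<omega> $ i)) (\<Sum>i\<in>UNIV. axis i (x $ i))"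
    by (intro has_bochner_integral_sum has_bochner_integral_bounded_linear[OF lin] assms)
  thus ?thesis by (simp only: eq[symmetric])
qed

section \<open>The walk matrix and the Laplacian of a weighted graph\<close>

context
  fixes E :: "'n::finite rel" and W :: "real^'n^'n" and \<sigma> :: real
  assumes graph: "weighted_graph E W"
begin

lemma weighted_degree_nonneg: "0 \<le> weighted_degree E W v"
  using graph unfolding weighted_degree_def weighted_graph_def by (intro sum_nonneg) (auto intro: less_imp_le)

lemma weighted_degree_pos:
  assumes "(v, w) \<in> E"
  shows "0 < weighted_degree E W v"
proof -
  have "0 < W $ v $ w" using graph assms by (auto simp: weighted_graph_def)
  also have "W $ v $ w \<le> weighted_degree E W v"
    using graph assms unfolding weighted_degree_def weighted_graph_def
    by (intro member_le_sum) (auto intro: less_imp_le)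
  finally show ?thesis .
qed

lemma walk_matrix_nonneg: "0 \<le> walk_matrix \<sigma> E W $ v $ w"
  using graph weighted_degree_nonneg
  by (auto simp: walk_matrix_def weighted_graph_def less_imp_le intro!: divide_nonneg_nonneg mult_nonneg_nonneg)

lemma transpose_walk_matrix: "transpose (walk_matrix \<sigma> E W) = walk_matrix \<sigma> E W"
proof -
  have "W $ i $ j = W $ j $ i" for i j
    using graph unfolding weighted_graph_def transpose_def by (metis vec_lambda_beta)
  moreover have "(i, j) \<in> E \<longleftrightarrow> (j, i) \<in> E" for i j
    using graph unfolding weighted_graph_def by (blast dest: symD)
  ultimately show ?thesis by (simp add: vec_eq_iff transpose_def walk_matrix_def mult.commute)
qed

text \<open>On isolated vertices any positive value would do.\<close>

definition sqrt_degree :: "'n \<Rightarrow> real" where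
  "sqrt_degree v = (if weighted_degree E W v = 0 then 1 else sqrt (weighted_degree E W v))"

lemma sqrt_degree_pos: "0 < sqrt_degree v"
  using weighted_degree_nonneg[of v] by (simp add: sqrt_degree_def)

text \<open>Square roots of the degrees form an eigenvector of the normalized adjacency matrix for
  the eigenvalue 1.\<close>

lemma walk_matrix_sqrt_degree_le:
  "(\<Sum>w\<in>UNIV. walk_matrix \<sigma> E W $ v $ w * sqrt_degree w) \<le> \<sigma>\<^sup>2 / (\<sigma>\<^sup>2 + 1) * sqrt_degree v"
proof -
  let ?s = "\<sigma>\<^sup>2 / (\<sigma>\<^sup>2 + 1)" and ?d = "weighted_degree E W"
  have "(\<Sum>w\<in>UNIV. walk_matrix \<sigma> E W $ v $ w * sqrt_degree w)
      = (\<Sum>w | (v, w) \<in> E. walk_matrix \<sigma> E W $ v $ w * sqrt_degree w)"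
    by (rule sum.mono_neutral_right) (auto simp: walk_matrix_def)
  also have "\<dots> = (\<Sum>w | (v, w) \<in> E. ?s / sqrt (?d v) * W $ v $ w)"
  proof (intro sum.cong refl)
    fix w assume "w \<in> {w. (v, w) \<in> E}"
    \<comment> \<open>The reversed edge makes the degree of w positive, so that
      \<open>sqrt_degree w\<close> cancels the root in the denominator.\<close>
    hence vw: "(v, w) \<in> E" and wv: "(w, v) \<in> E"
      using graph unfolding weighted_graph_def by (auto dest: symD)
    have "0 < ?d w" by (rule weighted_degree_pos[OF wv])
    thus "walk_matrix \<sigma> E W $ v $ w * sqrt_degree w = ?s / sqrt (?d v) * W $ v $ w"
      using vw by (simp add: walk_matrix_def sqrt_degree_def real_sqrt_mult)
  qed
  also have "\<dots> = ?s * (?d v / sqrt (?d v))"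
    unfolding sum_distrib_left[symmetric] by (simp add: weighted_degree_def)
  also have "?d v / sqrt (?d v) = sqrt (?d v)"
    by (rule real_div_sqrt[OF weighted_degree_nonneg])
  \<comment> \<open>The only loss is at degree 0, where \<open>sqrt_degree\<close> replaces 0 by
    1.\<close>
  also have "?s * sqrt (?d v) \<le> ?s * sqrt_degree v"
    by (intro mult_left_mono) (auto simp: sqrt_degree_def)
  finally show ?thesis .
qed

text \<open>The diagonals agree because a loopless graph gives the walk matrix a zero diagonal; off
  the diagonal the scalar cancels the denominator.\<close>

lemma laplacian_walk_matrix:
  "mat 1 + \<sigma>\<^sup>2 *\<^sub>R normalized_laplacian E W = (\<sigma>\<^sup>2 + 1) *\<^sub>R (mat 1 - walk_matrix \<sigma> E W)"
proof -
  have "\<sigma>\<^sup>2 + 1 \<noteq> 0" by (metis add_nonneg_pos less_irrefl zero_le_power2 zero_less_one)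
  moreover have "(v, v) \<notin> E" for v using graph by (auto simp: weighted_graph_def irrefl_def)
  ultimately show ?thesis
    by (auto simp: vec_eq_iff mat_def normalized_laplacian_def walk_matrix_def)
qed

end

section \<open>The kernel as an expected product of independent copies\<close>

theorem corollary3p3:
  fixes E :: "'n::finite rel" and W :: "real^'n^'n" and \<sigma> p_term :: real and m :: nat
    and hist :: "('n \<times> 'n) list \<Rightarrow> 'h" and strat :: "('n, 'h) strategy"
    and M :: "'a measure" and \<Phi> :: "'n \<Rightarrow> 'a \<Rightarrow> real^'n" and C C' :: "'a \<Rightarrow> real^'n^'n"
  assumes "weighted_graph E W"
    and "m \<ge> 1" and "0 < p_term" and "p_term < 1"
    and "sampling_strategy (walk_matrix \<sigma> E W) hist strat"
    and "nondegenerate (walk_matrix \<sigma> E W) hist strat"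
    and "prob_space M"
    and "prob_space.indep_vars M (\<lambda>_. borel) \<Phi> UNIV"
    and "\<And>i. distr M borel (\<Phi> i) = signature_law (walk_matrix \<sigma> E W) hist strat p_term m i"
    and "\<And>\<omega>. C \<omega> = (\<chi> i. (1 / (\<sigma>\<^sup>2 + 1)) *\<^sub>R \<Phi> i \<omega>)"
    and "prob_space.indep_var M borel C borel C'"
    and "distr M borel C' = distr M borel C"
  shows "invertible (mat 1 + \<sigma>\<^sup>2 *\<^sub>R normalized_laplacian E W) \<and>
         integrable M (\<lambda>\<omega>. C \<omega> ** transpose (C' \<omega>)) \<and>
         regularized_laplacian_kernel 2 \<sigma> E W =
           prob_space.expectation M (\<lambda>\<omega>. C \<omega> ** transpose (C' \<omega>))"
proof -
  interpret prob_space M by fact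
  note graph = assms(1)
  define U where "U = walk_matrix \<sigma> E W"
  define R where "R = matrix_inv (mat 1 - U)"
  define c where "c = \<sigma>\<^sup>2 + 1"
  define K where "K = mat 1 + \<sigma>\<^sup>2 *\<^sub>R normalized_laplacian E W"
  define B where "B = (1 / c) *\<^sub>R R"
  let ?x = "sqrt_degree E W" and ?s = "\<sigma>\<^sup>2 / (\<sigma>\<^sup>2 + 1)"
  have c: "c > 0" unfolding c_def by (simp add: add_nonneg_pos)
  have s: "0 \<le> ?s" "?s < 1" using c by (simp_all add: c_def)
  note x = sqrt_degree_pos[OF graph]
  note contr = walk_matrix_sqrt_degree_le[OF graph, of \<sigma>, folded U_def]
  note U_nonneg = walk_matrix_nonneg[OF graph, of \<sigma>, folded U_def]
  interpret random_walk U hist strat p_term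
    by unfold_locales (use assms(3-6) U_nonneg in \<open>auto simp: U_def\<close>)

  have inv: "invertible (mat 1 - U)"
    by (rule invertible_one_minus[of U, OF U_nonneg x s(2) contr])
  have R_nonneg: "0 \<le> R $ i $ j" for i j
    unfolding R_def by (rule matrix_inv_one_minus_nonneg[of U, OF U_nonneg x s(2) contr])
  have R: "(mat 1 - U) ** R = mat 1"
    using inv matrix_inv_eqI unfolding invertible_def R_def by metis
  hence R_eq: "R = mat 1 + U ** R"
    by (simp add: matrix_diff_rdistrib diff_eq_eq)
  have KB: "K ** B = mat 1"
    using R c laplacian_walk_matrix[OF graph, of \<sigma>, folded U_def]
    by (simp add: K_def B_def c_def[symmetric] scalar_matrix_assoc[symmetric] matrix_scalar_ac)
  hence BK: "B ** K = mat 1" using matrix_left_right_inverse by blast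
  have "transpose K = K"
    using laplacian_walk_matrix[OF graph, of \<sigma>] transpose_walk_matrix[OF graph, of \<sigma>]
    by (auto simp: K_def vec_eq_iff transpose_def mat_def)
  \<comment> \<open>The transpose of B also inverts K, so uniqueness of inverses makes B
    symmetric.\<close>
  hence "transpose B ** K = mat 1"
    using arg_cong[OF KB, of transpose] by (simp add: matrix_transpose_mul transpose_mat)
  hence B_sym: "transpose B = B"
    by (metis KB matrix_mul_assoc matrix_mul_lid matrix_mul_rid)

  have "matrix_power K 2 ** (B ** B) = mat 1"
    using KB by (simp add: matrix_power_def numeral_2_eq_2) (metis matrix_mul_assoc matrix_mul_rid)
  hence kernel: "regularized_laplacian_kernel 2 \<sigma> E W = B ** transpose B"
    unfolding regularized_laplacian_kernel_def K_def[symmetric] B_sym by (rule matrix_inv_eqI)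

  have \<Phi>_meas: "random_variable borel (\<Phi> i)" for i
    using assms(8) by (auto simp: indep_vars_def)
  have \<Phi>: "has_bochner_integral M (\<lambda>\<omega>. \<Phi> i \<omega> $ j) (R $ i $ j)" for i j
  proof -
    \<comment> \<open>Column j of \<open>U ** R\<close> counts what follows the initial visit;
      adding that visit gives column j of R.\<close>
    let ?H = "\<lambda>v. (U ** R) $ v $ j"
    have R_H: "(if v = j then 1 else 0) + ?H v = R $ v $ j" for v
      by (subst R_eq) (simp add: mat_def)
    have "has_bochner_integral (signature_law U hist strat p_term m i) (\<lambda>y. y $ j)
        ((if i = j then 1 else 0) + ?H i)"
    proof (rule has_bochner_integral_signature_law[OF x s contr _ _ assms(2)])
      show "0 \<le> ?H v" for v
        using U_nonneg R_nonneg by (simp add: matrix_matrix_mult_def sum_nonneg)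
      show "?H v = (\<Sum>w\<in>UNIV. U $ v $ w * ((if w = j then 1 else 0) + ?H w))" for v
        unfolding R_H by (simp add: matrix_matrix_mult_def)
    qed
    hence "has_bochner_integral (distr M borel (\<Phi> i)) (\<lambda>y. y $ j) (R $ i $ j)"
      by (simp only: R_H assms(9) U_def[symmetric])
    thus ?thesis
      using \<Phi>_meas unfolding has_bochner_integral_iff
      by (simp add: integrable_distr_eq integral_distr borel_measurable_continuous_onI continuous_intros)
  qed
  have entry_meas: "(\<lambda>A :: real^'n^'n. A $ i $ j) \<in> borel_measurable borel" for i j
    by (intro borel_measurable_continuous_onI continuous_intros)
  have C_meas: "random_variable borel C" and C'_meas: "random_variable borel C'"
    using indep_var_rv1[OF assms(11)] indep_var_rv2[OF assms(11)] .
  have C: "has_bochner_integral M (\<lambda>\<omega>. C \<omega> $ i $ j) (B $ i $ j)" for i j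
    using has_bochner_integral_mult_right[OF \<Phi>, of "1 / c" i j] by (simp add: assms(10) B_def c_def)
  \<comment> \<open>Means depend only on the law, so they transfer from \<open>C\<close> to its
    copy.\<close>
  have C': "has_bochner_integral M (\<lambda>\<omega>. C' \<omega> $ i $ j) (B $ i $ j)" for i j
  proof -
    have "has_bochner_integral (distr M borel C') (\<lambda>A. A $ i $ j) (B $ i $ j)"
      using C[of i j] C_meas entry_meas[of i j] unfolding assms(12) has_bochner_integral_iff
      by (simp add: integrable_distr_eq integral_distr)
    thus ?thesis
      using C'_meas entry_meas[of i j] unfolding has_bochner_integral_iff
      by (simp add: integrable_distr_eq integral_distr)
  qed
  \<comment> \<open>The copy matters on the diagonal: for i = j, using \<open>C\<close> twice would
    produce second moments instead of squared means.\<close>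
  have prod: "has_bochner_integral M (\<lambda>\<omega>. C \<omega> $ i $ k * C' \<omega> $ j $ k) (B $ i $ k * B $ j $ k)" for i j k
  proof -
    have indep: "indep_var borel (\<lambda>\<omega>. C \<omega> $ i $ k) borel (\<lambda>\<omega>. C' \<omega> $ j $ k)"
      using indep_var_compose[OF assms(11) entry_meas entry_meas, of i k j k] by (simp add: o_def)
    note int = C[of i k, unfolded has_bochner_integral_iff] C'[of j k, unfolded has_bochner_integral_iff]
    show ?thesis
      unfolding has_bochner_integral_iff
      using indep_var_integrable[OF indep] indep_var_lebesgue_integral[OF indep] int by simp
  qed
  \<comment> \<open>The vector rule is applied twice, to rows and then to entries; each entry is a
    sum of the products above.\<close>
  have "has_bochner_integral M (\<lambda>\<omega>. C \<omega> ** transpose (C' \<omega>)) (B ** transpose B)"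
    by (intro has_bochner_integral_vec)
       (simp add: matrix_matrix_mult_def transpose_def has_bochner_integral_sum prod)
  moreover have "invertible K" using KB BK unfolding invertible_def by blast
  ultimately show ?thesis
    unfolding kernel K_def[symmetric] has_bochner_integral_iff by simp
qed

end
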